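(* Let $n\in\mathbb{N}$ and let $\alpha,\beta,\gamma$ be compositions. For a quasi-ribbon word $w\in\mathcal{A}_n^*$ such that $\mathrm{QR}(w)$ has shape $\gamma$, let $S^w_{\alpha,\beta}$ be the set of pairs $(u,v)$ of quasi-ribbon words $u,v\in\mathcal{A}_n^*$ such that $\mathrm{QR}(u)$ has shape $\alpha$, $\mathrm{QR}(v)$ has shape $\beta$, and $w\equiv_{\mathrm{hypo}} uv$. Then $|S^w_{\alpha,\beta}|$ depends only on $\alpha,\beta,\gamma$: if $w,w'\in\mathcal{A}_n^*$ are quasi-ribbon words whose quasi-ribbon tableaux both have shape $\gamma$, then $|S^w_{\alpha,\beta}|=|S^{w'}_{\alpha,\beta}|$.
   Context: $\mathcal{A}_n=\{1<\dots<n\}$. A composition $\alpha=(\alpha_1,\dots,\alpha_k)$ has positive parts. A ribbon diagram of shape $\alpha$ has $\alpha_h$ boxes in row $h$, the leftmost box of each row directly below the rightmost box of the previous row. A quasi-ribbon tableau is such a diagram filled with positive integers, rows weakly increasing left to right and columns strictly increasing top to bottom. Its column reading is the word obtained by reading columns from leftmost to rightmost, each from bottom to top; a quasi-ribbon word is the column reading of some quasi-ribbon tableau. Insertion of $a$ into a quasi-ribbon tableau $T$: if no entry of $T$ is $\le a$ (or $T$ empty), create a cell $a$ with $T$ attached so its first cell is directly below $a$; if no entry is $>a$, attach a new cell $a$ directly right of the last cell of $T$; otherwise let $x$ be the last cell (along the ribbon, top-left to bottom-right) with entry $\le a$ and $z$ the next cell, and form the part of $T$ up to $x$, a new cell $a$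 directly right of $x$, and the rest of $T$ from $z$ attached with $z$ directly below the new cell. $\mathrm{QR}(w)$ is obtained by inserting the letters of $w$ left to right into the empty tableau. $u\equiv_{\mathrm{hypo}}v$ iff $\mathrm{QR}(u)=\mathrm{QR}(v)$; this is a congruence on $\mathcal{A}_n^*$ and the quotient is the hypoplactic monoid of rank $n$. For a quasi-ribbon word $u$, $\mathrm{QR}(u)$ is the quasi-ribbon tableau whose column reading is $u$. *)

theory Defs
  imports Main
begin

text \<open>
  A filled ribbon diagram is given by its list of rows, from top to bottom. Since the leftmost
  box of each row is directly below the rightmost box of the previous one, the position of
  every box is determined by the row lengths.
\<close>

type_synonym tableau = "nat list list"

definition composition :: "nat list \<Rightarrow> bool" where
  "composition \<alpha> \<longleftrightarrow> (\<forall>a\<in>set \<alpha>. 0 < a)"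

definition words :: "nat \<Rightarrow> nat list set" where
  "words n = lists {1..n}"

definition shape :: "tableau \<Rightarrow> nat list" where
  "shape T = map length T"

text \<open>The index, counted from 0, of the column of the leftmost box of row \<open>h\<close>.\<close>

definition row_offset :: "tableau \<Rightarrow> nat \<Rightarrow> nat" where
  "row_offset T h = (\<Sum>i<h. length (T ! i) - 1)"

text \<open>The entries in column \<open>c\<close>, from top to bottom.\<close>

definition column :: "tableau \<Rightarrow> nat \<Rightarrow> nat list" where
  "column T c =
     map (\<lambda>h. T ! h ! (c - row_offset T h))
       (filter (\<lambda>h. row_offset T h \<le> c \<and> c < row_offset T h + length (T ! h)) [0..<length T])"

definition quasi_ribbon_tableau :: "tableau \<Rightarrow> bool" where
  "quasi_ribbon_tableau T \<longleftrightarrow>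
     composition (shape T) \<and>
     (\<forall>r\<in>set T. sorted r \<and> (\<forall>x\<in>set r. 0 < x)) \<and>
     (\<forall>c. sorted_wrt (<) (column T c))"

text \<open>The last column of a nonempty ribbon has index \<open>row_offset T (length T)\<close>.\<close>

definition column_reading :: "tableau \<Rightarrow> nat list" where
  "column_reading T = concat (map (\<lambda>c. rev (column T c)) [0..<Suc (row_offset T (length T))])"

definition quasi_ribbon_word :: "nat list \<Rightarrow> bool" where
  "quasi_ribbon_word u \<longleftrightarrow> (\<exists>T. quasi_ribbon_tableau T \<and> u = column_reading T)"

text \<open>
  The cells of a ribbon, ordered along it from top left to bottom right, are listed by
  \<open>concat T\<close>. The functions \<open>take_cells k T\<close> and \<open>drop_cells k T\<close> are the
  ribbons formed by the first \<open>k\<close> cells and by the remaining ones.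
\<close>

fun take_cells :: "nat \<Rightarrow> tableau \<Rightarrow> tableau" where
  "take_cells k [] = []"
| "take_cells k (r # T) = (if k = 0 then [] else take k r # take_cells (k - length r) T)"

fun drop_cells :: "nat \<Rightarrow> tableau \<Rightarrow> tableau" where
  "drop_cells k [] = []"
| "drop_cells k (r # T) = (if k < length r then drop k r # T else drop_cells (k - length r) T)"

definition attach_right :: "tableau \<Rightarrow> nat \<Rightarrow> tableau" where
  "attach_right T a = butlast T @ [last T @ [a]]"

text \<open>
  In the third case \<open>x\<close> is the cell with index \<open>k\<close> along the ribbon. The cell
  \<open>z\<close> after it becomes the first cell of a row, which puts it directly below the new cell.
\<close>

definition insert_letter :: "nat \<Rightarrow> tableau \<Rightarrow> tableau" where
  "insert_letter a T =
     (if \<forall>y\<in>set (concat T). \<not> y \<le> a then [a] # T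
      else if \<forall>y\<in>set (concat T). \<not> y > a then attach_right T a
      else let k = Max {i \<in> {..<length (concat T)}. concat T ! i \<le> a}
           in attach_right (take_cells (Suc k) T) a @ drop_cells (Suc k) T)"

definition QR :: "nat list \<Rightarrow> tableau" where
  "QR w = fold insert_letter w []"

definition hypoplactic_cong :: "nat list \<Rightarrow> nat list \<Rightarrow> bool" where
  "hypoplactic_cong u v \<longleftrightarrow> QR u = QR v"

definition factor_pairs :: "nat \<Rightarrow> nat list \<Rightarrow> nat list \<Rightarrow> nat list \<Rightarrow> (nat list \<times> nat list) set" where
  "factor_pairs n \<alpha> \<beta> w =
     {(u, v). u \<in> words n \<and> v \<in> words n \<and>
              quasi_ribbon_word u \<and> quasi_ribbon_word v \<and>
              shape (QR u) = \<alpha> \<and> shape (QR v) = \<beta> \<and>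
              hypoplactic_cong w (u @ v)}"

text \<open>
  A word has as many letters as its tableau has cells, so \<open>factor_pairs\<close> is finite and
  \<open>card\<close> measures it faithfully.
\<close>

lemma take_cells_0: "take_cells 0 T = []"
  by (cases T) auto

lemma length_drop_cells_0: "length (concat (drop_cells 0 T)) = length (concat T)"
  by (induction T) auto

lemma length_take_drop_cells:
  "length (concat (take_cells k T)) + length (concat (drop_cells k T)) = length (concat T)"
proof (induction T arbitrary: k)
  case (Cons r T)
  show ?case
    using Cons.IH[of "k - length r"] length_drop_cells_0[of T]
    by (auto simp: take_cells_0 simp del: length_concat)
qed simp

lemma take_cells_not_Nil: "T \<noteq> [] \<Longrightarrow> 0 < k \<Longrightarrow> take_cells k T \<noteq> []"
  by (cases T) auto

lemma length_attach_right:
  "T \<noteq> [] \<Longrightarrow> length (concat (attach_right T a)) = Suc (length (concat T))"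
  by (cases T rule: rev_cases) (auto simp: attach_right_def)

lemma length_insert_letter: "length (concat (insert_letter a T)) = Suc (length (concat T))"
proof (cases "T = []")
  case False
  have "length (concat (attach_right (take_cells (Suc k) T) a @ drop_cells (Suc k) T))
      = Suc (length (concat T))" for k
    using length_attach_right[OF take_cells_not_Nil[OF False], of "Suc k" a]
      length_take_drop_cells[of "Suc k" T] by (simp del: length_concat)
  then show ?thesis
    using length_attach_right[OF False, of a]
    by (simp add: insert_letter_def Let_def del: length_concat concat_append)
qed (simp add: insert_letter_def)

lemma length_QR: "sum_list (shape (QR w)) = length w"
proof -
  have "length (concat (fold insert_letter w T)) = length (concat T) + length w" for T
    by (induction w arbitrary: T) (simp_all add: length_insert_letter del: length_concat)
  from this[of "[]"] show ?thesis
    by (simp add: QR_def shape_def length_concat)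
qed

lemma finite_factor_pairs: "finite (factor_pairs n \<alpha> \<beta> w)"
proof (rule finite_subset)
  let ?W = "\<lambda>m. {xs. set xs \<subseteq> {1..n} \<and> length xs = m}"
  show "factor_pairs n \<alpha> \<beta> w \<subseteq> ?W (sum_list \<alpha>) \<times> ?W (sum_list \<beta>)"
    using length_QR by (auto simp: factor_pairs_def words_def lists_eq_set)
  show "finite (?W (sum_list \<alpha>) \<times> ?W (sum_list \<beta>))"
    by (intro finite_cartesian_product finite_lists_length_eq) simp_all
qed

end

theory Submission
  imports Defs "HOL-Library.Multiset"
begin

text \<open>
  Standardization: let \<open>s\<close> list the letters of \<open>w\<close> in increasing order. A word \<open>u\<close> with these
  letters is \<open>map (\<lambda>i. s ! i) p\<close> for a unique arrangement \<open>p\<close> of the positions in which the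
  positions of equal letters increase from left to right. Insertion only compares a new letter with
  earlier ones, and the comparisons come out the same in \<open>p\<close> and in \<open>u\<close>, so that \<open>QR u\<close> is
  obtained from \<open>QR p\<close> by replacing positions by letters. Conversely, letters strictly increase
  from one row of \<open>QR w\<close> to the next, which forces every \<open>p\<close> with
  \<open>shape (QR p) = shape (QR w)\<close> to have its equal letters in the right order. Hence the pairs
  counted for \<open>w\<close> are in bijection with pairs of words in the positions, on which only the
  three shapes impose a condition.
\<close>

section \<open>Insertion into ribbons\<close>

text \<open>The quasi-ribbon condition without columns: consecutive rows share a column, so with
  sorted rows strict columns amount to strict increase from row to row. Positivity is left out
  because positions, which start at 0, will also serve as letters.\<close>

definition ribbon :: "tableau \<Rightarrow> bool" where
  "ribbon T \<longleftrightarrow> (\<forall>r\<in>set T. r \<noteq> [] \<and> sorted r) \<and>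
     sorted_wrt (\<lambda>r s. \<forall>x\<in>set r. \<forall>y\<in>set s. x < y) T"

lemma ribbon_Nil [simp]: "ribbon []"
  by (simp add: ribbon_def)

lemma ribbon_Cons:
  "ribbon (r # T) \<longleftrightarrow>
     r \<noteq> [] \<and> sorted r \<and> (\<forall>x\<in>set r. \<forall>y\<in>set (concat T). x < y) \<and> ribbon T"
  by (auto simp: ribbon_def)

lemma ribbon_append:
  "ribbon (S @ T) \<longleftrightarrow>
     ribbon S \<and> ribbon T \<and> (\<forall>x\<in>set (concat S). \<forall>y\<in>set (concat T). x < y)"
  by (simp add: ribbon_def sorted_wrt_append) blast

lemma sorted_concat_ribbon: "ribbon T \<Longrightarrow> sorted (concat T)"
  by (induction T) (auto simp: ribbon_Cons sorted_append less_imp_le)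

text \<open>In a ribbon \<open>A @ (r1 @ r2) # B\<close> cut in this way, the letter \<open>a\<close> is inserted after \<open>r1\<close>.\<close>

definition cut :: "nat \<Rightarrow> tableau \<Rightarrow> nat list \<Rightarrow> nat list \<Rightarrow> tableau \<Rightarrow> bool" where
  "cut a A r1 r2 B \<longleftrightarrow>
     (\<forall>x\<in>set (concat A) \<union> set r1. x \<le> a) \<and> (\<forall>x\<in>set r2 \<union> set (concat B). a < x) \<and>
     (r1 = [] \<longrightarrow> A = [])"

text \<open>The row to cut is the last one with an entry at most \<open>a\<close>, or the top row if
  there is none. Hence an empty \<open>r1\<close> forces an empty \<open>A\<close>.\<close>

lemma ex_cut:
  assumes "ribbon T" "T \<noteq> []"
  shows "\<exists>A r1 r2 B. T = A @ (r1 @ r2) # B \<and> cut a A r1 r2 B"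
  using assms
proof (induction T)
  case (Cons r T)
  show ?case
  proof (cases "\<exists>y\<in>set r. a < y")
    case True
    define r1 where "r1 = takeWhile (\<lambda>x. x \<le> a) r"
    define r2 where "r2 = dropWhile (\<lambda>x. x \<le> a) r"
    have r: "r = r1 @ r2"
      by (simp add: r1_def r2_def)
    have "r2 \<noteq> []"
      using True by (auto simp: r2_def dropWhile_eq_Nil_conv not_le)
    moreover have "sorted r2"
      using Cons.prems r by (auto simp: ribbon_Cons sorted_append)
    moreover have "a < hd r2"
      using \<open>r2 \<noteq> []\<close> hd_dropWhile[of "\<lambda>x. x \<le> a" r] by (simp add: r2_def)
    ultimately have r2: "\<forall>x\<in>set r2. a < x"
      by (cases r2) auto
    have "\<forall>x\<in>set (concat T). a < x"
      using True Cons.prems by (fastforce simp: ribbon_Cons)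
    then have "cut a [] r1 r2 T"
      using r2 by (auto simp: cut_def r1_def dest: set_takeWhileD)
    then show ?thesis
      using r by (metis append_Nil)
  next
    case False
    then have r: "\<forall>x\<in>set r. x \<le> a"
      by (auto simp: not_less)
    have "r \<noteq> []" and T: "ribbon T"
      using Cons.prems by (auto simp: ribbon_Cons)
    show ?thesis
    proof (cases "\<forall>x\<in>set (concat T). a < x")
      case True
      then have "cut a [] r [] T"
        using r by (auto simp: cut_def)
      then show ?thesis
        by (metis append_Nil append_Nil2)
    next
      case False
      then have "T \<noteq> []"
        by auto
      then obtain A r1 r2 B where AB: "T = A @ (r1 @ r2) # B" "cut a A r1 r2 B"
        using Cons.IH T by blast
      \<comment> \<open>An empty \<open>r1\<close> would make \<open>A\<close> empty, and then every
        entry of \<open>T\<close> would exceed \<open>a\<close>.\<close>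
      then have "r1 \<noteq> []"
        using False by (auto simp: cut_def)
      then have "cut a (r # A) r1 r2 B"
        using AB r by (auto simp: cut_def)
      then show ?thesis
        using AB(1) by (metis append_Cons)
    qed
  qed
qed simp

lemma take_cells_append:
  "r1 \<noteq> [] \<Longrightarrow> take_cells (length (concat A @ r1)) (A @ (r1 @ r2) # B) = A @ [r1]"
  by (induction A) (auto simp: take_cells_0)

lemma drop_cells_append:
  assumes "\<forall>r\<in>set B. r \<noteq> []" "r1 @ r2 \<noteq> []"
  shows "drop_cells (length (concat A @ r1)) (A @ (r1 @ r2) # B) =
    (if r2 = [] then B else r2 # B)"
proof -
  have "drop_cells 0 B = B"
    using assms(1) by (cases B) auto
  then show ?thesis
    using assms(2) by (induction A) auto
qed

text \<open>One formula for all three cases of insertion: \<open>r1\<close> is empty in the first,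
  \<open>r2\<close> and \<open>B\<close> are empty in the second. The \<open>if\<close> avoids an
  empty row when the cut falls at the end of a row. Sortedness is not assumed, so the formula also
  applies to relabelled tableaux.\<close>

lemma insert_letter_cut:
  assumes "cut a A r1 r2 B" "\<forall>r\<in>set B. r \<noteq> []" "r1 @ r2 \<noteq> []"
  shows "insert_letter a (A @ (r1 @ r2) # B) =
    A @ (r1 @ [a]) # (if r2 = [] then B else r2 # B)"
proof (cases "r1 = []")
  case True
  then show ?thesis
    using assms by (auto simp: insert_letter_def cut_def not_le)
next
  case r1: False
  let ?T = "A @ (r1 @ r2) # B"
  have le: "\<not> (\<forall>y\<in>set (concat ?T). \<not> y \<le> a)"
    using assms(1) r1 by (auto simp: cut_def neq_Nil_conv)
  show ?thesis
  proof (cases "r2 = [] \<and> B = []")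
    case True
    then have "\<forall>y\<in>set (concat ?T). \<not> y > a"
      using assms(1) by (auto simp: cut_def not_less)
    then show ?thesis
      using True le by (simp add: insert_letter_def attach_right_def)
  next
    case False
    then have gt: "\<not> (\<forall>y\<in>set (concat ?T). \<not> y > a)"
      using assms by (cases B) (auto simp: cut_def neq_Nil_conv)
    define l where "l = concat A @ r1"
    define m where "m = r2 @ concat B"
    have T: "concat ?T = l @ m"
      by (simp add: l_def m_def)
    have l: "\<forall>x\<in>set l. x \<le> a" and m: "\<forall>x\<in>set m. a < x" and "l \<noteq> []"
      using assms(1) r1 by (auto simp: cut_def l_def m_def)
    \<comment> \<open>The entries at most \<open>a\<close> form the initial segment \<open>l\<close>
      of the reading, so the maximal index is \<open>length l - 1\<close>.\<close>
    have "{i \<in> {..<length (concat ?T)}. concat ?T ! i \<le> a} = {..<length l}"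
      unfolding T using l m by (force simp: nth_append not_le[symmetric])
    moreover have "Max {..<length l} = length l - 1"
      using \<open>l \<noteq> []\<close> by (intro Max_eqI) auto
    ultimately have "Suc (Max {i \<in> {..<length (concat ?T)}. concat ?T ! i \<le> a}) = length l"
      using \<open>l \<noteq> []\<close> by simp
    then show ?thesis
      using take_cells_append[OF r1, of A r2 B] drop_cells_append[OF assms(2,3), of A]
      unfolding insert_letter_def Let_def l_def[symmetric] if_not_P[OF le] if_not_P[OF gt]
      by (simp add: attach_right_def del: concat_append)
  qed
qed

lemma insert_letter_Nil [simp]: "insert_letter a [] = [[a]]"
  by (simp add: insert_letter_def)

lemma insert_letter_cases:
  assumes "ribbon T"
  obtains "T = []" "insert_letter a T = [[a]]"
  | A r1 r2 B where "T = A @ (r1 @ r2) # B" "cut a A r1 r2 B" "r1 @ r2 \<noteq> []"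
      "\<forall>r\<in>set B. r \<noteq> []"
      "insert_letter a T = A @ (r1 @ [a]) # (if r2 = [] then B else r2 # B)"
proof (cases "T = []")
  case False
  then obtain A r1 r2 B where *: "T = A @ (r1 @ r2) # B" "cut a A r1 r2 B"
    using ex_cut assms by blast
  then have ne: "r1 @ r2 \<noteq> []" "\<forall>r\<in>set B. r \<noteq> []"
    using assms by (auto simp: ribbon_def)
  show thesis
    using that(2)[OF * ne] insert_letter_cut[OF *(2) ne(2,1)] *(1) by simp
qed (use that(1) in simp)

lemma mset_insert_letter:
  assumes "ribbon T"
  shows "mset (concat (insert_letter a T)) = add_mset a (mset (concat T))"
  using assms by (cases rule: insert_letter_cases[where a = a]) auto

lemma ribbon_insert_letter:
  assumes "ribbon T"
  shows "ribbon (insert_letter a T)"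
  using assms
proof (cases rule: insert_letter_cases[where a = a])
  case (2 A r1 r2 B)
  have le: "\<forall>x\<in>set (concat A) \<union> set r1. x \<le> a"
    and gt: "\<forall>x\<in>set r2 \<union> set (concat B). a < x"
    using 2(2) by (simp_all add: cut_def)
  have AB: "ribbon A" "ribbon B" "sorted r1" "sorted r2"
    and A: "\<forall>x\<in>set (concat A). \<forall>y\<in>set r1. x < y"
      "\<forall>x\<in>set (concat A). \<forall>y\<in>set r2 \<union> set (concat B). x < y"
    and r: "\<forall>x\<in>set r1 \<union> set r2. \<forall>y\<in>set (concat B). x < y"
    using assms unfolding 2(1) by (simp_all add: ribbon_append ribbon_Cons sorted_append ball_Un)
  \<comment> \<open>\<open>cut\<close> gives only a weak inequality; strictness comes from an entry
    of \<open>r1\<close>, which exceeds all of \<open>A\<close> and is at most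
    \<open>a\<close>.\<close>
  have "\<forall>x\<in>set (concat A). x < a"
  proof (cases r1)
    case Nil
    then show ?thesis
      using 2(2) by (simp add: cut_def)
  next
    case (Cons y ys)
    then show ?thesis
      using A(1) le by (meson UnI2 list.set_intros(1) less_le_trans)
  qed
  moreover have "\<forall>x\<in>set r1. \<forall>y\<in>set r2 \<union> set (concat B). x < y"
    using le gt by (meson UnI2 le_less_trans)
  ultimately show ?thesis
    using AB A r le gt unfolding 2(5)
    by (simp add: ribbon_append ribbon_Cons sorted_append ball_Un)
qed (simp add: ribbon_Cons)

text \<open>A weakly increasing \<open>f\<close> may merge letters. The cut survives as long as no
  entry larger than \<open>a\<close> is merged with \<open>a\<close>, since such an entry would move
  to the other side of the cut.\<close>

lemma insert_letter_map:
  assumes "ribbon T" "mono_on (insert a (set (concat T))) f"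
    and "\<And>y. y \<in> set (concat T) \<Longrightarrow> f y = f a \<Longrightarrow> y \<le> a"
  shows "insert_letter (f a) (map (map f) T) = map (map f) (insert_letter a T)"
  using assms(1)
proof (cases rule: insert_letter_cases[where a = a])
  case (2 A r1 r2 B)
  have le: "f x \<le> f a" if "x \<in> set (concat T)" "x \<le> a" for x
    using mono_onD[OF assms(2)] that by auto
  have less: "f a < f x" if "x \<in> set (concat T)" "a < x" for x
    using mono_onD[OF assms(2), of a x] assms(3)[of x] that by (auto simp: less_le)
  have "cut (f a) (map (map f) A) (map f r1) (map f r2) (map (map f) B)"
  proof -
    have "\<forall>x\<in>set (concat A) \<union> set r1. f x \<le> f a" "\<forall>x\<in>set r2 \<union> set (concat B). f a < f x"
      using 2(2) le less unfolding 2(1) cut_def by auto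
    then show ?thesis
      using 2(2) by (auto simp: cut_def)
  qed
  from insert_letter_cut[OF this] show ?thesis
    using 2(3-5) unfolding 2(1) by auto
qed simp

lemma insert_letter_snoc_row:
  assumes "ribbon T" "T \<noteq> []" "a < c"
  shows "insert_letter a (T @ [[c]]) = insert_letter a T @ [[c]]"
  using assms(1)
proof (cases rule: insert_letter_cases[where a = a])
  case (2 A r1 r2 B)
  then have "cut a A r1 r2 (B @ [[c]])"
    using assms(3) by (auto simp: cut_def)
  from insert_letter_cut[OF this] show ?thesis
    using 2 by auto
qed (use assms in simp)

lemma insert_letter_last:
  assumes "ribbon (T @ [r])" "\<forall>x\<in>set (concat (T @ [r])). x \<le> a"
  shows "insert_letter a (T @ [r]) = T @ [r @ [a]]"
proof -
  have r: "cut a T r [] []" "r \<noteq> []"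
    using assms by (auto simp: cut_def ribbon_append ribbon_Cons)
  from insert_letter_cut[OF r(1)] show ?thesis
    using r(2) by simp
qed

text \<open>Insertion puts all entries larger than \<open>a\<close> into rows below that of
  \<open>a\<close>, so a ribbon image keeps them distinct from \<open>a\<close>. Rejoining
  \<open>r1\<close> and \<open>r2\<close> gives a sorted row because \<open>f\<close> is
  monotone.\<close>

lemma ribbon_map_insert_letterD:
  assumes "ribbon T" "mono_on (insert a (set (concat T))) f"
    and "ribbon (map (map f) (insert_letter a T))"
  shows "ribbon (map (map f) T)"
    and "\<And>y. y \<in> set (concat T) \<Longrightarrow> f y = f a \<Longrightarrow> y \<le> a"
proof -
  have *: "ribbon (map (map f) T) \<and> (\<forall>y\<in>set (concat T). f y = f a \<longrightarrow> y \<le> a)"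
    using assms(1)
  proof (cases rule: insert_letter_cases[where a = a])
    case (2 A r1 r2 B)
    have "sorted (r1 @ r2)"
      using assms(1) 2(1) by (simp add: ribbon_append ribbon_Cons)
    then have "sorted (map f (r1 @ r2))"
      unfolding sorted_map
      by (rule sorted_wrt_mono_rel[rotated]) (use assms(2) 2(1) in \<open>auto intro: mono_onD\<close>)
    moreover have "\<forall>x\<in>set r2. f a < f x" "\<forall>x\<in>set (concat B). f a < f x"
      using assms(3) 2(5) by (auto simp: ribbon_append ribbon_Cons split: if_splits)
    moreover have "\<forall>x\<in>set r2. \<forall>y\<in>set (concat B). f x < f y"
      using assms(3) 2(5) by (auto simp: ribbon_append ribbon_Cons split: if_splits)
    ultimately show ?thesis
      using assms(3) 2(2,3,5) unfolding 2(1) cut_def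
      by (fastforce simp: ribbon_append ribbon_Cons split: if_splits)
  qed simp
  show "ribbon (map (map f) T)"
    using * by blast
  show "y \<le> a" if "y \<in> set (concat T)" "f y = f a" for y
    using * that by blast
qed

section \<open>The tableau of a word\<close>

lemma QR_Nil [simp]: "QR [] = []"
  by (simp add: QR_def)

lemma QR_snoc [simp]: "QR (p @ [a]) = insert_letter a (QR p)"
  by (simp add: QR_def)

lemma ribbon_QR: "ribbon (QR p)"
  by (induction p rule: rev_induct) (auto simp: ribbon_insert_letter)

lemma mset_QR: "mset (concat (QR p)) = mset p"
  by (induction p rule: rev_induct) (auto simp: mset_insert_letter ribbon_QR simp del: mset_concat)

lemma set_QR: "set (concat (QR p)) = set p"
  using mset_QR mset_eq_setD by blast

section \<open>Standardization of words\<close>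

definition fibre_sorted :: "(nat \<Rightarrow> nat) \<Rightarrow> nat list \<Rightarrow> bool" where
  "fibre_sorted f = sorted_wrt (\<lambda>x y. f x = f y \<longrightarrow> x \<le> y)"

text \<open>When \<open>p\<close> arranges positions, \<open>fibre_sorted f p\<close> says that
  \<open>p\<close> is the standardization of \<open>map f p\<close>. It provides the merging
  condition of \<open>insert_letter_map\<close> at every insertion.\<close>

lemma QR_map:
  "mono_on (set p) f \<Longrightarrow> fibre_sorted f p \<Longrightarrow> QR (map f p) = map (map f) (QR p)"
proof (induction p rule: rev_induct)
  case (snoc a p)
  then have "QR (map f p) = map (map f) (QR p)"
    by (auto simp: fibre_sorted_def sorted_wrt_append intro: mono_on_subset)
  moreover have "insert_letter (f a) (map (map f) (QR p)) = map (map f) (insert_letter a (QR p))"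
    using snoc.prems unfolding fibre_sorted_def
    by (intro insert_letter_map ribbon_QR) (auto simp: set_QR sorted_wrt_append simp del: set_concat)
  ultimately show ?case
    by simp
qed simp

text \<open>Insertions are undone from the last one on: each gives the condition on its own letter
  and leaves a tableau whose image is again a ribbon.\<close>

lemma fibre_sorted_if_ribbon_map_QR:
  "mono_on (set p) f \<Longrightarrow> ribbon (map (map f) (QR p)) \<Longrightarrow> fibre_sorted f p"
proof (induction p rule: rev_induct)
  case (snoc a p)
  note * = ribbon_map_insert_letterD[OF ribbon_QR[of p], of a f]
  show ?case
    using snoc.IH mono_on_subset[OF snoc.prems(1), of "set p"] *[unfolded set_QR] snoc.prems
    by (auto simp: fibre_sorted_def sorted_wrt_append)
qed (simp add: fibre_sorted_def)

text \<open>Each first entry is the least element of its fibre in the common multiset, so the first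
  entries agree.\<close>

lemma fibre_sorted_unique:
  "\<lbrakk>map f p = map f q; mset p = mset q; fibre_sorted f p; fibre_sorted f q\<rbrakk> \<Longrightarrow> p = q"
proof (induction p arbitrary: q)
  case (Cons x p)
  then obtain y q' where q: "q = y # q'"
    by (cases q) auto
  have "x \<in> set q" "y \<in> set (x # p)"
    using Cons.prems(2) q by (metis list.set_intros(1) mset_eq_setD)+
  then have "x = y"
    using Cons.prems q by (fastforce simp: fibre_sorted_def)
  then show ?case
    using Cons q by (auto simp: fibre_sorted_def)
qed simp

text \<open>Greedy choice: every letter of \<open>u\<close>, from left to right, takes the least
  remaining element of its fibre.\<close>

lemma ex_fibre_sorted:
  "mset u = image_mset f M \<Longrightarrow> \<exists>p. map f p = u \<and> mset p = M \<and> fibre_sorted f p"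
proof (induction u arbitrary: M)
  case (Cons a u)
  define x where "x = (LEAST x. x \<in># M \<and> f x = a)"
  have "\<exists>x. x \<in># M \<and> f x = a"
    using Cons.prems by (metis imageE list.set_intros(1) set_image_mset set_mset_mset)
  from LeastI_ex[OF this] have x: "x \<in># M" "f x = a"
    by (auto simp: x_def)
  have least: "x \<le> y" if "y \<in># M" "f y = a" for y
    using that by (auto simp: x_def intro: Least_le)
  obtain M' where M: "M = add_mset x M'"
    using multi_member_split[OF x(1)] by blast
  then obtain p where "map f p = u" "mset p = M'" "fibre_sorted f p"
    using Cons.IH[of M'] Cons.prems x(2) by auto
  then have "map f (x # p) = a # u \<and> mset (x # p) = M \<and> fibre_sorted f (x # p)"
    using x M least by (auto simp: fibre_sorted_def)
  then show ?case
    by (intro exI[of _ "x # p"])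
qed (simp add: fibre_sorted_def)

section \<open>Column readings\<close>

lemma row_offset_append: "h \<le> length S \<Longrightarrow> row_offset (S @ T) h = row_offset S h"
  by (auto simp: row_offset_def nth_append intro!: sum.cong)

lemma row_offset_mono: "h \<le> k \<Longrightarrow> row_offset T h \<le> row_offset T k"
  unfolding row_offset_def by (intro sum_mono2) auto

lemma row_offset_snoc:
  "row_offset (T @ [r]) (length (T @ [r])) = row_offset T (length T) + (length r - 1)"
  using row_offset_append[of "length T" T "[r]"] by (simp add: row_offset_def)

text \<open>A new bottom row leaves the earlier offsets unchanged, which is why tableaux are built
  up from the top in the inductions below.\<close>

lemma column_snoc:
  "column (T @ [r]) c = column T c @
     (let k = row_offset T (length T) in if k \<le> c \<and> c < k + length r then [r ! (c - k)] else [])"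
proof -
  let ?P = "\<lambda>S h. row_offset S h \<le> c \<and> c < row_offset S h + length (S ! h)"
  have "filter (?P (T @ [r])) [0..<length T] = filter (?P T) [0..<length T]"
    by (rule filter_cong) (auto simp: row_offset_append nth_append)
  then show ?thesis
    by (auto simp: column_def row_offset_append nth_append Let_def)
qed

lemma column_Nil [simp]: "column [] c = []"
  by (simp add: column_def)

lemma column_beyond:
  assumes "\<forall>r\<in>set T. r \<noteq> []" "row_offset T (length T) < c"
  shows "column T c = []"
proof -
  have "row_offset T h + length (T ! h) \<le> c" if "h < length T" for h
  proof -
    \<comment> \<open>Row \<open>h\<close> ends in column \<open>row_offset T (Suc h)\<close>, so no
      row reaches beyond the last column.\<close>
    have "row_offset T (Suc h) \<le> row_offset T (length T)"
      using that by (intro row_offset_mono) simp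
    moreover have "row_offset T (Suc h) = row_offset T h + (length (T ! h) - 1)"
      by (simp add: row_offset_def)
    moreover have "T ! h \<noteq> []"
      using assms(1) that nth_mem by blast
    ultimately show ?thesis
      using assms(2) by (cases "T ! h") auto
  qed
  then show ?thesis
    by (fastforce simp: column_def filter_empty_conv)
qed

lemma set_column: "set (column T c) \<subseteq> set (concat T)"
  by (induction T rule: rev_induct) (auto simp: column_snoc Let_def)

lemma column_map: "column (map (map f) T) c = map f (column T c)"
proof (induction T rule: rev_induct)
  case (snoc r T)
  have "row_offset (map (map f) T) (length T) = row_offset T (length T)"
    by (simp add: row_offset_def)
  then show ?case
    using snoc by (auto simp: column_snoc Let_def)
qed simp

lemma column_reading_map: "column_reading (map (map f) T) = map f (column_reading T)"
proof -
  have "row_offset (map (map f) T) (length T) = row_offset T (length T)"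
    by (simp add: row_offset_def)
  then show ?thesis
    by (simp add: column_reading_def column_map map_concat rev_map comp_def del: upt_Suc)
qed

section \<open>Agreement of ribbons with quasi-ribbon tableaux, up to positivity\<close>

lemma column_sorted: "ribbon T \<Longrightarrow> sorted_wrt (<) (column T c)"
proof (induction T rule: rev_induct)
  case (snoc r T)
  then show ?case
    using set_column[of T c]
    by (fastforce simp: ribbon_append column_snoc Let_def sorted_wrt_append)
qed simp

lemma last_column:
  assumes "r \<noteq> []"
  shows "column (T @ [r]) (row_offset (T @ [r]) (length (T @ [r]))) =
    column T (row_offset T (length T) + (length r - 1)) @ [last r]"
  using assms unfolding column_snoc row_offset_snoc
  by (cases r) (auto simp: Let_def last_conv_nth)

text \<open>The column shared by \<open>T\<close> and \<open>r\<close> gives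
  \<open>last t < hd r\<close>; these are the maximum of \<open>T\<close> and the minimum of
  \<open>r\<close>.\<close>

lemma ribbon_if_quasi_ribbon_tableau: "quasi_ribbon_tableau T \<Longrightarrow> ribbon T"
proof (induction T rule: rev_induct)
  case (snoc r T)
  have ne: "\<forall>s\<in>set (T @ [r]). s \<noteq> []"
    using snoc.prems by (auto simp: quasi_ribbon_tableau_def composition_def shape_def)
  have "sorted_wrt (<) (column T c)" for c
    using snoc.prems by (auto simp: quasi_ribbon_tableau_def column_snoc sorted_wrt_append)
  then have T: "ribbon T"
    using snoc by (auto simp: quasi_ribbon_tableau_def composition_def shape_def)
  have "x < y" if xy: "x \<in> set (concat T)" "y \<in> set r" for x y
  proof -
    obtain T' t where T': "T = T' @ [t]"
      using xy(1) by (cases T rule: rev_cases) auto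
    let ?k = "row_offset T (length T)"
    have "last t \<in> set (column T ?k)"
      using last_column[of t T'] ne T' by simp
    moreover have "hd r \<in> set (column (T @ [r]) ?k)" "column (T @ [r]) ?k = column T ?k @ [hd r]"
      using ne by (auto simp: column_snoc hd_conv_nth)
    moreover have "sorted_wrt (<) (column (T @ [r]) ?k)"
      using snoc.prems by (simp add: quasi_ribbon_tableau_def)
    ultimately have "last t < hd r"
      by (auto simp: sorted_wrt_append)
    moreover have "x \<le> last t"
    proof -
      have "concat T = concat T' @ butlast t @ [last t]"
        using ne T' by simp
      with sorted_concat_ribbon[OF T] xy(1) show ?thesis
        by (auto simp: sorted_append simp del: append_butlast_last_id)
    qed
    moreover have "hd r \<le> y"
      using snoc.prems xy(2) by (cases r) (auto simp: quasi_ribbon_tableau_def)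
    ultimately show ?thesis
      by simp
  qed
  then show ?case
    using T ne snoc.prems by (auto simp: ribbon_append ribbon_Cons quasi_ribbon_tableau_def)
qed simp

lemma quasi_ribbon_tableau_if_ribbon:
  "ribbon T \<Longrightarrow> \<forall>x\<in>set (concat T). 0 < x \<Longrightarrow> quasi_ribbon_tableau T"
  using column_sorted
  by (fastforce simp: ribbon_def quasi_ribbon_tableau_def composition_def shape_def)

section \<open>Recovering a ribbon from its column reading\<close>

lemma column_reading_snoc:
  assumes "\<forall>s\<in>set T. s \<noteq> []" "r \<noteq> []"
  shows "column_reading (T @ [r]) =
    concat (map (\<lambda>c. rev (column T c)) [0..<row_offset T (length T)]) @
      hd r # rev (column T (row_offset T (length T))) @ tl r"
proof -
  let ?k = "row_offset T (length T)"
  have "concat (map (\<lambda>c. rev (column (T @ [r]) c)) [0..<?k]) =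
      concat (map (\<lambda>c. rev (column T c)) [0..<?k])"
    by (intro arg_cong[where f = concat] map_cong) (auto simp: column_snoc Let_def)
  \<comment> \<open>Only the head of \<open>r\<close> joins a column of \<open>T\<close>, at its
    bottom; the other cells form columns of their own.\<close>
  moreover have "rev (column (T @ [r]) ?k) = hd r # rev (column T ?k)"
    using assms(2) by (simp add: column_snoc hd_conv_nth)
  moreover have "concat (map (\<lambda>c. rev (column (T @ [r]) c)) [Suc ?k..<?k + length r]) = tl r"
  proof -
    have "map (\<lambda>c. rev (column (T @ [r]) c)) [Suc ?k..<?k + length r] = map (\<lambda>x. [x]) (tl r)"
      using column_beyond[OF assms(1)]
      by (intro nth_equalityI) (auto simp: column_snoc Let_def nth_tl)
    then show ?thesis
      by simp
  qed
  moreover have "[0..<Suc (row_offset (T @ [r]) (length (T @ [r])))] =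
      [0..<?k] @ ?k # [Suc ?k..<?k + length r]"
  proof -
    have "[0..<?k + length r] = [0..<?k] @ [?k..<?k + length r]"
      using upt_add_eq_append by blast
    moreover have "[?k..<?k + length r] = ?k # [Suc ?k..<?k + length r]"
      using assms(2) by (intro upt_conv_Cons) simp
    moreover have "Suc (?k + (length r - 1)) = ?k + length r"
      using assms(2) by (cases r) auto
    ultimately show ?thesis
      unfolding row_offset_snoc by metis
  qed
  ultimately show ?thesis
    unfolding column_reading_def by (simp del: upt_Suc)
qed

lemma set_column_reading: "set (column_reading T) \<subseteq> set (concat T)"
  using set_column by (fastforce simp: column_reading_def simp del: upt_Suc)

lemma fold_insert_letter_snoc_row:
  "\<lbrakk>ribbon T; T \<noteq> []; \<forall>a\<in>set p. a < c\<rbrakk>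
    \<Longrightarrow> fold insert_letter p (T @ [[c]]) = fold insert_letter p T @ [[c]]"
proof (induction p arbitrary: T)
  case (Cons a p)
  have "insert_letter a T \<noteq> []"
    using length_insert_letter[of a T] by auto
  then show ?case
    using Cons by (simp add: insert_letter_snoc_row ribbon_insert_letter)
qed simp

lemma fold_insert_letter_last_row:
  "ribbon (T @ [r @ s]) \<Longrightarrow> r \<noteq> [] \<Longrightarrow> fold insert_letter s (T @ [r]) = T @ [r @ s]"
proof (induction s arbitrary: r)
  case (Cons a s)
  have "ribbon (T @ [r])" "\<forall>x\<in>set (concat T). x < a" "\<forall>x\<in>set r. x \<le> a"
    using Cons.prems by (simp_all add: ribbon_append ribbon_Cons sorted_append ball_Un)
  then have "insert_letter a (T @ [r]) = T @ [r @ [a]]"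
    by (intro insert_letter_last) (auto dest: less_imp_le)
  then show ?case
    using Cons.IH[of "r @ [a]"] Cons.prems by simp
qed simp

text \<open>
  The head \<open>c\<close> of a new row sits at the bottom of the last column, so it is read before the
  rest \<open>b # q\<close> of that column although it exceeds all of it.
\<close>

lemma QR_insert_max:
  assumes "\<forall>x\<in>set p. x \<le> b" "\<forall>x\<in>set (b # q). x < c"
  shows "QR (p @ c # b # q) = QR (p @ b # q) @ [[c]]"
proof -
  \<comment> \<open>Inserted first, \<open>c\<close> ends the last row; \<open>b\<close> then cuts
    it off as a row of its own, which the smaller letters of \<open>q\<close> leave
    untouched.\<close>
  have "insert_letter b (insert_letter c (QR p)) = insert_letter b (QR p) @ [[c]]"
  proof (cases "QR p" rule: rev_cases)
    case Nil
    have "cut b [] [] [c] []"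
      using assms by (auto simp: cut_def)
    from insert_letter_cut[OF this] Nil show ?thesis
      by simp
  next
    case (snoc T r)
    have R: "ribbon (T @ [r])"
      using ribbon_QR[of p] snoc by simp
    have le: "\<forall>x\<in>set (concat (T @ [r])). x \<le> b"
      using assms(1) set_QR[of p] snoc by simp
    then have "insert_letter b (T @ [r]) = T @ [r @ [b]]"
      using R insert_letter_last by blast
    moreover have "insert_letter c (T @ [r]) = T @ [r @ [c]]"
      using R le assms(2)
      by (intro insert_letter_last) (meson less_imp_le list.set_intros(1) order.trans)+
    moreover have "r \<noteq> []" "cut b T r [c] []"
      using R le assms(2) by (auto simp: cut_def ribbon_append ribbon_Cons)
    ultimately show ?thesis
      using insert_letter_cut[of b T r "[c]" "[]"] snoc by simp
  qed
  moreover have "insert_letter b (QR p) \<noteq> []"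
    using length_insert_letter[of b "QR p"] by auto
  ultimately show ?thesis
    using assms(2) fold_insert_letter_snoc_row[of "insert_letter b (QR p)" q c]
      ribbon_insert_letter[OF ribbon_QR]
    by (simp add: QR_def)
qed

text \<open>Induction on the rows: \<open>hd r\<close> is read before the last column of
  \<open>T\<close> but ends up as a new bottom row by \<open>QR_insert_max\<close>, and
  \<open>tl r\<close> then extends that row.\<close>

lemma QR_column_reading: "ribbon T \<Longrightarrow> QR (column_reading T) = T"
proof (induction T rule: rev_induct)
  case Nil
  then show ?case
    by (simp add: column_reading_def row_offset_def)
next
  case (snoc r T)
  have r: "r \<noteq> []" "hd r # tl r = r" and T: "ribbon T" "\<forall>s\<in>set T. s \<noteq> []"
    using snoc.prems by (auto simp: ribbon_def sorted_wrt_append)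
  let ?k = "row_offset T (length T)"
  define p where "p = concat (map (\<lambda>c. rev (column T c)) [0..<?k])"
  define q where "q = rev (column T ?k)"
  have cr: "column_reading T = p @ q"
    by (simp add: column_reading_def p_def q_def)
  have "QR (p @ hd r # q) = T @ [[hd r]]"
  proof (cases T rule: rev_cases)
    case Nil
    then show ?thesis
      by (simp add: p_def q_def QR_def row_offset_def)
  next
    case (snoc T' t)
    then have t: "t \<noteq> []"
      using T(2) by simp
    \<comment> \<open>The last cell of \<open>T\<close> is the bottom of its last column, so the
      maximum of \<open>T\<close> is the first letter of \<open>q\<close>.\<close>
    have "q = last t # tl q"
      using last_column[OF t, of T'] snoc by (simp add: q_def)
    moreover have "\<forall>x\<in>set (concat T). x \<le> last t"
    proof -
      have "concat T = concat T' @ butlast t @ [last t]"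
        using t snoc by simp
      with sorted_concat_ribbon[OF T(1)] show ?thesis
        by (auto simp: sorted_append simp del: append_butlast_last_id)
    qed
    moreover have "\<forall>x\<in>set (concat T). x < hd r"
      using snoc.prems r(1) by (simp add: ribbon_append)
    moreover have "set (p @ q) \<subseteq> set (concat T)"
      using set_column_reading[of T] cr by simp
    ultimately have "QR (p @ hd r # last t # tl q) = QR (p @ last t # tl q) @ [[hd r]]"
      by (intro QR_insert_max) (metis Un_iff set_append subsetD)+
    then show ?thesis
      using \<open>q = last t # tl q\<close> snoc.IH T(1) cr by simp
  qed
  moreover have "column_reading (T @ [r]) = (p @ hd r # q) @ tl r"
    using column_reading_snoc[OF T(2) r(1)] by (simp add: p_def q_def)
  ultimately show ?case
    using fold_insert_letter_last_row[of T "[hd r]" "tl r"] snoc.prems r(2)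
    by (simp add: QR_def)
qed

text \<open>\<open>QR\<close> inverts the column reading of ribbons, so \<open>QR u\<close> is the
  only possible witness.\<close>

lemma quasi_ribbon_word_iff:
  assumes "\<forall>x\<in>set u. 0 < x"
  shows "quasi_ribbon_word u \<longleftrightarrow> column_reading (QR u) = u"
proof
  assume "quasi_ribbon_word u"
  then show "column_reading (QR u) = u"
    using QR_column_reading ribbon_if_quasi_ribbon_tableau by (auto simp: quasi_ribbon_word_def)
next
  assume "column_reading (QR u) = u"
  moreover have "quasi_ribbon_tableau (QR u)"
    using assms by (intro quasi_ribbon_tableau_if_ribbon ribbon_QR) (simp only: set_QR)
  ultimately show "quasi_ribbon_word u"
    by (metis quasi_ribbon_word_def)
qed

text \<open>For the forward direction, \<open>?q\<close> has the same tableau as \<open>p\<close>,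
  whose image is a ribbon. So both words are standardizations of \<open>map f p\<close>, and these
  are unique.\<close>

lemma column_reading_QR_map_iff:
  assumes "mono_on (set p) f" "fibre_sorted f p"
  shows "column_reading (QR (map f p)) = map f p \<longleftrightarrow> column_reading (QR p) = p"
proof
  let ?q = "column_reading (QR p)"
  have map: "column_reading (QR (map f p)) = map f ?q"
    using QR_map[OF assms] by (simp add: column_reading_map)
  {
    assume "?q = p"
    then show "column_reading (QR (map f p)) = map f p"
      using map by simp
  next
    assume eq: "column_reading (QR (map f p)) = map f p"
    have QR: "QR ?q = QR p"
      using QR_column_reading ribbon_QR by blast
    then have mset: "mset ?q = mset p"
      by (metis mset_QR)
    have "ribbon (map (map f) (QR ?q))"
      using QR QR_map[OF assms] ribbon_QR by metis
    then have "fibre_sorted f ?q"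
      using assms(1) mset_eq_setD[OF mset] by (simp add: fibre_sorted_if_ribbon_map_QR)
    then show "?q = p"
      using fibre_sorted_unique[of f ?q p] eq map mset assms(2) by simp
  }
qed

section \<open>Counting factorizations\<close>

text \<open>The counterpart of \<open>factor_pairs\<close> for positions. The fixed-point equations
  stand in for \<open>quasi_ribbon_word\<close>, which would exclude the position 0.\<close>

definition standard_pairs :: "nat list \<Rightarrow> nat list \<Rightarrow> nat list \<Rightarrow> (nat list \<times> nat list) set" where
  "standard_pairs \<alpha> \<beta> \<gamma> =
     {(x, y). mset (x @ y) = mset [0..<sum_list \<gamma>] \<and>
              column_reading (QR x) = x \<and> column_reading (QR y) = y \<and>
              shape (QR x) = \<alpha> \<and> shape (QR y) = \<beta> \<and> shape (QR (x @ y)) = \<gamma>}"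

lemma tableau_eqI: "concat S = concat T \<Longrightarrow> shape S = shape T \<Longrightarrow> S = T"
proof (induction S arbitrary: T)
  case (Cons r S)
  then show ?case
    by (cases T) (auto simp: shape_def)
qed (auto simp: shape_def)

lemma shape_map [simp]: "shape (map (map f) T) = shape T"
  by (simp add: shape_def)

lemma card_factor_pairs:
  assumes "w \<in> words n"
  shows "card (factor_pairs n \<alpha> \<beta> w) = card (standard_pairs \<alpha> \<beta> (shape (QR w)))"
proof -
  \<comment> \<open>A ribbon read along its cells is sorted, so \<open>s\<close> lists the letters
    of \<open>w\<close> in increasing order.\<close>
  define s where "s = concat (QR w)"
  define N where "N = sum_list (shape (QR w))"
  define f where "f = (\<lambda>i. s ! i)"
  let ?P = "standard_pairs \<alpha> \<beta> (shape (QR w))"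
  have mset_s: "mset s = mset w"
    by (simp only: s_def mset_QR)
  have N: "N = length s"
    by (simp add: N_def s_def shape_def length_concat)
  have mono: "mono_on A f" if "A \<subseteq> {..<N}" for A
    using sorted_concat_ribbon[OF ribbon_QR] that
    by (force simp: f_def N s_def monotone_on_def intro: sorted_nth_mono)
  have map_f: "map f [0..<N] = s"
    by (simp add: f_def N map_nth)
  have set: "set p = {..<N}" if "mset p = mset [0..<N]" for p
    using mset_eq_setD[OF that] by (simp add: lessThan_atLeast0)
  have words: "set u \<subseteq> {1..n}" if "mset u = mset w" for u
    using mset_eq_setD[OF that] assms by (auto simp: words_def)
  \<comment> \<open>The reading of \<open>QR p\<close> is \<open>[0..<N]\<close>, so relabelling by
    \<open>f\<close> turns \<open>QR p\<close> into \<open>QR w\<close>, which is a ribbon.\<close>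
  have sorted: "fibre_sorted f p"
    if p: "mset p = mset [0..<N]" "shape (QR p) = shape (QR w)" for p
  proof -
    have "concat (QR p) = [0..<N]"
      using p(1) mset_QR sorted_concat_ribbon[OF ribbon_QR]
      by (metis properties_for_sort sorted_upt)
    then have "map (map f) (QR p) = QR w"
      using p(2) map_f by (intro tableau_eqI) (simp_all add: map_concat[symmetric] s_def)
    then show ?thesis
      using mono set[OF p(1)] by (intro fibre_sorted_if_ribbon_map_QR) (simp_all add: ribbon_QR)
  qed
  \<comment> \<open>A ribbon is determined by its letters and its shape, because its reading is
    sorted.\<close>
  have eq_QR: "hypoplactic_cong w u \<longleftrightarrow> mset u = mset w \<and> shape (QR u) = shape (QR w)" for u
  proof
    assume "mset u = mset w \<and> shape (QR u) = shape (QR w)"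
    then show "hypoplactic_cong w u"
      unfolding hypoplactic_cong_def
      by (metis mset_QR properties_for_sort ribbon_QR sorted_concat_ribbon tableau_eqI)
  qed (metis hypoplactic_cong_def mset_QR)
  have iff: "(map f x, map f y) \<in> factor_pairs n \<alpha> \<beta> w \<longleftrightarrow> (x, y) \<in> ?P"
    if p: "mset (x @ y) = mset [0..<N]" "fibre_sorted f (x @ y)" for x y
  proof -
    have fs: "fibre_sorted f x" "fibre_sorted f y"
      using p(2) by (auto simp: fibre_sorted_def sorted_wrt_append)
    have mo: "mono_on (set x) f" "mono_on (set y) f" "mono_on (set (x @ y)) f"
      using set[OF p(1)] by (auto intro!: mono)
    note QR = fs[THEN QR_map[rotated]] p(2)[THEN QR_map[rotated]]
    have m: "mset (map f (x @ y)) = mset w"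
      by (metis map_f mset_map mset_s p(1))
    have "\<forall>a\<in>set (map f x). 0 < a" "\<forall>a\<in>set (map f y). 0 < a"
      "map f x \<in> words n" "map f y \<in> words n"
      using words[OF m] by (auto simp: words_def)
    moreover have "hypoplactic_cong w (map f x @ map f y) \<longleftrightarrow>
        shape (QR (x @ y)) = shape (QR w)"
      using eq_QR[of "map f (x @ y)"] m QR(3) mo by simp
    ultimately show ?thesis
      using QR mo p column_reading_QR_map_iff[OF mo(1) fs(1)]
        column_reading_QR_map_iff[OF mo(2) fs(2)]
      unfolding factor_pairs_def standard_pairs_def N_def
      by (simp add: quasi_ribbon_word_iff)
  qed
  have P: "mset (x @ y) = mset [0..<N]" "fibre_sorted f (x @ y)" if "(x, y) \<in> ?P" for x y
    using that sorted[of "x @ y"] by (auto simp: standard_pairs_def N_def)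
  have "bij_betw (map_prod (map f) (map f)) ?P (factor_pairs n \<alpha> \<beta> w)"
    unfolding bij_betw_def
  proof
    show "inj_on (map_prod (map f) (map f)) ?P"
    proof (rule inj_onI)
      fix p p'
      assume p: "p \<in> ?P" "p' \<in> ?P" "map_prod (map f) (map f) p = map_prod (map f) (map f) p'"
      obtain x y x' y' where xy: "p = (x, y)" "p' = (x', y')"
        by fastforce
      have eq: "map f x = map f x'" "map f y = map f y'"
        using p(3) xy by simp_all
      \<comment> \<open>Uniqueness is applied to the concatenations, since the multisets of the
        factors are not known to agree; the lengths then separate the factors.\<close>
      then have "x @ y = x' @ y'"
        using P[OF p(1)[unfolded xy]] P[OF p(2)[unfolded xy]]
        by (metis fibre_sorted_unique map_append)
      moreover have "length x = length x'"
        using eq(1) by (metis length_map)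
      ultimately show "p = p'"
        using xy by simp
    qed
    show "map_prod (map f) (map f) ` ?P = factor_pairs n \<alpha> \<beta> w"
    proof
      show "map_prod (map f) (map f) ` ?P \<subseteq> factor_pairs n \<alpha> \<beta> w"
      proof (rule image_subsetI)
        fix p
        assume "p \<in> ?P"
        then show "map_prod (map f) (map f) p \<in> factor_pairs n \<alpha> \<beta> w"
          using iff[OF P] by (cases p) simp
      qed
      show "factor_pairs n \<alpha> \<beta> w \<subseteq> map_prod (map f) (map f) ` ?P"
      proof clarify
        fix u v
        assume uv: "(u, v) \<in> factor_pairs n \<alpha> \<beta> w"
        then have "mset (u @ v) = mset s"
          using eq_QR[of "u @ v"] mset_s by (simp add: factor_pairs_def)
        then have "mset (u @ v) = image_mset f (mset [0..<N])"
          by (metis map_f mset_map)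
        \<comment> \<open>The product \<open>u @ v\<close> is standardized as a whole and split
          afterwards, so that the two factors use disjoint sets of positions.\<close>
        then obtain p where p: "map f p = u @ v" "mset p = mset [0..<N]" "fibre_sorted f p"
          using ex_fibre_sorted by blast
        then obtain x y where xy: "p = x @ y" "u = map f x" "v = map f y"
          by (metis map_eq_append_conv)
        then have "(x, y) \<in> ?P"
          using iff[of x y] p(2,3) uv by simp
        then show "(u, v) \<in> map_prod (map f) (map f) ` ?P"
          using xy(2,3) by (intro image_eqI[of _ _ "(x, y)"]) simp_all
      qed
    qed
  qed
  then show ?thesis
    by (simp add: bij_betw_same_card)
qed

theorem theorem9p1:
  fixes n :: nat and \<alpha> \<beta> \<gamma> w w' :: "nat list"
  assumes "composition \<alpha>" and "composition \<beta>" and "composition \<gamma>"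
    and "w \<in> words n" and "quasi_ribbon_word w" and "shape (QR w) = \<gamma>"
    and "w' \<in> words n" and "quasi_ribbon_word w'" and "shape (QR w') = \<gamma>"
  shows "card (factor_pairs n \<alpha> \<beta> w) = card (factor_pairs n \<alpha> \<beta> w')"
  using assms by (simp add: card_factor_pairs)

end
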